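(* Let $(E,\mathscr{T},\le)$ be a locally convex $T_2$-preordered space whose topology $\mathscr{T}$ is locally compact and $\sigma$-compact. Then $(E,\mathscr{T},\le)$ is a convex normally preordered space (and hence it is quasi-uniformizable).
   Context: A topological preordered space is a triple $(E,\mathscr{T},\le)$ with $(E,\mathscr{T})$ a topological space (not assumed Hausdorff) and $\le$ a reflexive and transitive relation. Locally compact means that each point has a compact neighborhood (compactness does not include Hausdorffness). Set $i(x)=\{y: x\le y\}$, $d(x)=\{y: y\le x\}$, $i(S)=\bigcup_{x\in S} i(x)$, $d(S)=\bigcup_{x\in S} d(x)$. A set $S$ is increasing if $i(S)=S$, decreasing if $d(S)=S$, and convex if it is the intersection of a decreasing and an increasing set (equivalently $S=d(S)\cap i(S)$). The space is $T_1$-preordered if all $i(x)$ and $d(x)$ are closed; $T_2$-preordered if the graph $G(\le)=\{(x,y):x\le y\}$ is closed in $E\times E$. It is normally preordered if it is $T_1$-preordered and for every closed decreasing $A$ and closed increasing $B$ with $A\cap B=\emptyset$ there are an open decreasing $U\supset A$ and an open increasing $V\supset B$ with $U\cap V=\emptyset$. The space is convex at $x$ if for every open neighborhood $O$ of $x$ there are an open decreasing set $U$ and an open increasing set $V$ with $x\in U\cap V\subset O$; it is locally convex at $x$ if the convex neighborhoods of $x$ form a base of the neighborhood system of $x$. The space is convex (locally convex) if it is so at every point. A quasi-uniformity on $E$ is a filter $\mathcal{U}$ on $E\times E$ whose elements contain the diagonal and such that for every $V\in\mathcal{U}$ there is $W\in\mathcal{U}$ with $W\circ W\subset V$. $\mathcal{U}^*$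 is the coarsest uniformity containing $\mathcal{U}$, given by the sets $V\cap W^{-1}$, $V,W\in\mathcal{U}$; $\mathscr{T}(\mathcal{U}^* )$ is its topology, with neighborhoods of $x$ generated by the sets $U(x)=\{y:(x,y)\in U\}$, $U\in\mathcal{U}^*$. $(E,\mathscr{T},\le)$ is quasi-uniformizable if there is a quasi-uniformity $\mathcal{U}$ on $E$ with $\mathscr{T}=\mathscr{T}(\mathcal{U}^* )$ and $G(\le)=\bigcap\mathcal{U}$. *)

theory Defs
  imports "HOL-Analysis.Analysis"
begin

text \<open>A topological preordered space \<open>(E, T, \<le>)\<close> is given by a topology \<open>X\<close> with
  \<open>E = topspace X\<close> and a relation \<open>R\<close> with \<open>preorder_on (topspace X) R\<close>, where
  \<open>(x, y) \<in> R\<close> means \<open>x \<le> y\<close>. Thus \<open>R\<close> is the graph of \<open>\<le>\<close>,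
  \<open>i(S) = R `` S\<close> and \<open>d(S) = R\<inverse> `` S\<close>.\<close>

definition increasing_set :: "('a \<times> 'a) set \<Rightarrow> 'a set \<Rightarrow> bool" where
  "increasing_set R S \<longleftrightarrow> R `` S = S"

definition decreasing_set :: "('a \<times> 'a) set \<Rightarrow> 'a set \<Rightarrow> bool" where
  "decreasing_set R S \<longleftrightarrow> R\<inverse> `` S = S"

definition order_convex_set :: "('a \<times> 'a) set \<Rightarrow> 'a set \<Rightarrow> bool" where
  "order_convex_set R S \<longleftrightarrow> (\<exists>D I. decreasing_set R D \<and> increasing_set R I \<and> S = D \<inter> I)"

definition T1_preordered :: "'a topology \<Rightarrow> ('a \<times> 'a) set \<Rightarrow> bool" where
  "T1_preordered X R \<longleftrightarrow>
     (\<forall>x \<in> topspace X. closedin X (R `` {x}) \<and> closedin X (R\<inverse> `` {x}))"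

definition T2_preordered :: "'a topology \<Rightarrow> ('a \<times> 'a) set \<Rightarrow> bool" where
  "T2_preordered X R \<longleftrightarrow> closedin (prod_topology X X) R"

definition normally_preordered :: "'a topology \<Rightarrow> ('a \<times> 'a) set \<Rightarrow> bool" where
  "normally_preordered X R \<longleftrightarrow> T1_preordered X R \<and>
     (\<forall>A B. closedin X A \<and> decreasing_set R A \<and> closedin X B \<and> increasing_set R B \<and> A \<inter> B = {} \<longrightarrow>
        (\<exists>U V. openin X U \<and> decreasing_set R U \<and> A \<subseteq> U \<and>
               openin X V \<and> increasing_set R V \<and> B \<subseteq> V \<and> U \<inter> V = {}))"

definition order_convex_at :: "'a topology \<Rightarrow> ('a \<times> 'a) set \<Rightarrow> 'a \<Rightarrow> bool" where
  "order_convex_at X R x \<longleftrightarrow>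
     (\<forall>O'. openin X O' \<and> x \<in> O' \<longrightarrow>
        (\<exists>U V. openin X U \<and> decreasing_set R U \<and> openin X V \<and> increasing_set R V \<and>
               x \<in> U \<inter> V \<and> U \<inter> V \<subseteq> O'))"

definition order_convex_space :: "'a topology \<Rightarrow> ('a \<times> 'a) set \<Rightarrow> bool" where
  "order_convex_space X R \<longleftrightarrow> (\<forall>x \<in> topspace X. order_convex_at X R x)"

text \<open>The neighbourhoods in \<^const>\<open>neighbourhood_base_at\<close> need not be open.\<close>

definition locally_order_convex_at :: "'a topology \<Rightarrow> ('a \<times> 'a) set \<Rightarrow> 'a \<Rightarrow> bool" where
  "locally_order_convex_at X R x \<longleftrightarrow> neighbourhood_base_at x (order_convex_set R) X"

definition locally_order_convex_space :: "'a topology \<Rightarrow> ('a \<times> 'a) set \<Rightarrow> bool" where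
  "locally_order_convex_space X R \<longleftrightarrow> (\<forall>x \<in> topspace X. locally_order_convex_at X R x)"

definition sigma_compact_space :: "'a topology \<Rightarrow> bool" where
  "sigma_compact_space X \<longleftrightarrow>
     (\<exists>\<K>. countable \<K> \<and> (\<forall>K \<in> \<K>. compactin X K) \<and> \<Union>\<K> = topspace X)"

text \<open>The first four conditions say that \<open>\<U>\<close> is a filter of subsets of \<open>E \<times> E\<close>. Properness is
  not required separately: it follows from the diagonal condition unless \<open>E = {}\<close>, and the
  empty set carries the quasi-uniformity \<open>{{}}\<close>.\<close>

definition quasi_uniformity_on :: "'a set \<Rightarrow> ('a \<times> 'a) set set \<Rightarrow> bool" where
  "quasi_uniformity_on E \<U> \<longleftrightarrow>
     \<U> \<noteq> {} \<and>
     (\<forall>V \<in> \<U>. V \<subseteq> E \<times> E) \<and>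
     (\<forall>V \<in> \<U>. \<forall>W \<in> \<U>. V \<inter> W \<in> \<U>) \<and>
     (\<forall>V \<in> \<U>. \<forall>W. V \<subseteq> W \<and> W \<subseteq> E \<times> E \<longrightarrow> W \<in> \<U>) \<and>
     (\<forall>V \<in> \<U>. Id_on E \<subseteq> V) \<and>
     (\<forall>V \<in> \<U>. \<exists>W \<in> \<U>. W O W \<subseteq> V)"

text \<open>The coarsest uniformity containing \<open>\<U>\<close>. No upward closure is needed: a superset
  \<open>S \<subseteq> E \<times> E\<close> of \<open>V \<inter> W\<inverse>\<close> equals \<open>(V \<union> S) \<inter> (W \<union> S\<inverse>)\<inverse>\<close>.\<close>

definition sym_uniformity :: "('a \<times> 'a) set set \<Rightarrow> ('a \<times> 'a) set set" where
  "sym_uniformity \<U> = {V \<inter> W\<inverse> | V W. V \<in> \<U> \<and> W \<in> \<U>}"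

definition uniformity_topology :: "'a set \<Rightarrow> ('a \<times> 'a) set set \<Rightarrow> 'a topology" where
  "uniformity_topology E \<U> = topology (\<lambda>S. S \<subseteq> E \<and> (\<forall>x \<in> S. \<exists>V \<in> \<U>. V `` {x} \<subseteq> S))"

definition quasi_uniformizable :: "'a topology \<Rightarrow> ('a \<times> 'a) set \<Rightarrow> bool" where
  "quasi_uniformizable X R \<longleftrightarrow>
     (\<exists>\<U>. quasi_uniformity_on (topspace X) \<U> \<and>
          X = uniformity_topology (topspace X) (sym_uniformity \<U>) \<and>
          R = \<Inter>\<U>)"

lemma quasi_uniformity_onD:
  assumes "quasi_uniformity_on E \<U>"
  shows "\<U> \<noteq> {}"
    and "V \<in> \<U> \<Longrightarrow> V \<subseteq> E \<times> E"
    and "V \<in> \<U> \<Longrightarrow> W \<in> \<U> \<Longrightarrow> V \<inter> W \<in> \<U>"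
    and "V \<in> \<U> \<Longrightarrow> V \<subseteq> S \<Longrightarrow> S \<subseteq> E \<times> E \<Longrightarrow> S \<in> \<U>"
    and "V \<in> \<U> \<Longrightarrow> Id_on E \<subseteq> V"
    and "V \<in> \<U> \<Longrightarrow> \<exists>W \<in> \<U>. W O W \<subseteq> V"
proof -
  note * = assms[unfolded quasi_uniformity_on_def]
  show "\<U> \<noteq> {}" using * by (elim conjE)
  show "V \<subseteq> E \<times> E" if "V \<in> \<U>" using *[THEN conjunct2, THEN conjunct1] that by (rule bspec)
  show "V \<inter> W \<in> \<U>" if "V \<in> \<U>" "W \<in> \<U>"
    using *[THEN conjunct2, THEN conjunct2, THEN conjunct1, THEN bspec, OF that(1)] that(2)
    by (rule bspec)
  show "S \<in> \<U>" if "V \<in> \<U>" "V \<subseteq> S" "S \<subseteq> E \<times> E"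
    using *[THEN conjunct2, THEN conjunct2, THEN conjunct2, THEN conjunct1, THEN bspec, OF that(1)]
      that(2,3) by simp
  show "Id_on E \<subseteq> V" if "V \<in> \<U>"
    using *[THEN conjunct2, THEN conjunct2, THEN conjunct2, THEN conjunct2, THEN conjunct1] that
    by (rule bspec)
  show "\<exists>W \<in> \<U>. W O W \<subseteq> V" if "V \<in> \<U>"
    using *[THEN conjunct2, THEN conjunct2, THEN conjunct2, THEN conjunct2, THEN conjunct2] that
    by (rule bspec)
qed

lemma quasi_uniformity_on_sym_uniformity:
  assumes "quasi_uniformity_on E \<U>"
  shows "quasi_uniformity_on E (sym_uniformity \<U>)"
proof -
  note ne = quasi_uniformity_onD(1)[OF assms] and sub = quasi_uniformity_onD(2)[OF assms]
    and int = quasi_uniformity_onD(3)[OF assms] and up = quasi_uniformity_onD(4)[OF assms]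
    and diag = quasi_uniformity_onD(5)[OF assms] and comp = quasi_uniformity_onD(6)[OF assms]
  have mem: "V \<inter> W\<inverse> \<in> sym_uniformity \<U>" if "V \<in> \<U>" "W \<in> \<U>" for V W
    using that unfolding sym_uniformity_def by blast
  show ?thesis
    unfolding quasi_uniformity_on_def
  proof (intro conjI ballI allI impI)
    show "sym_uniformity \<U> \<noteq> {}" using ne mem by blast
  next
    fix V assume "V \<in> sym_uniformity \<U>"
    then show "V \<subseteq> E \<times> E" unfolding sym_uniformity_def using sub by blast
  next
    fix P Q assume "P \<in> sym_uniformity \<U>" "Q \<in> sym_uniformity \<U>"
    then obtain V W V' W' where *: "P = V \<inter> W\<inverse>" "Q = V' \<inter> W'\<inverse>"
      "V \<in> \<U>" "W \<in> \<U>" "V' \<in> \<U>" "W' \<in> \<U>"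
      unfolding sym_uniformity_def by blast
    then have "P \<inter> Q = (V \<inter> V') \<inter> (W \<inter> W')\<inverse>" by blast
    then show "P \<inter> Q \<in> sym_uniformity \<U>" using mem int * by metis
  next
    fix P S assume "P \<in> sym_uniformity \<U>" and S: "P \<subseteq> S \<and> S \<subseteq> E \<times> E"
    then obtain V W where *: "P = V \<inter> W\<inverse>" "V \<in> \<U>" "W \<in> \<U>"
      unfolding sym_uniformity_def by blast
    have "V \<union> S \<in> \<U>" using sub[OF *(2)] S by (intro up[OF *(2)]) blast+
    moreover have "W \<union> S\<inverse> \<in> \<U>" using sub[OF *(3)] S by (intro up[OF *(3)]) blast+
    moreover have "S = (V \<union> S) \<inter> (W \<union> S\<inverse>)\<inverse>" using * S by blast
    ultimately show "S \<in> sym_uniformity \<U>" using mem by metis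
  next
    fix V assume "V \<in> sym_uniformity \<U>"
    then show "Id_on E \<subseteq> V" unfolding sym_uniformity_def using diag by blast
  next
    fix P assume "P \<in> sym_uniformity \<U>"
    then obtain V W where *: "P = V \<inter> W\<inverse>" "V \<in> \<U>" "W \<in> \<U>"
      unfolding sym_uniformity_def by blast
    obtain V' W' where **: "V' \<in> \<U>" "V' O V' \<subseteq> V" "W' \<in> \<U>" "W' O W' \<subseteq> W"
      using comp * by meson
    have "(V' \<inter> W'\<inverse>) O (V' \<inter> W'\<inverse>) \<subseteq> (V' O V') \<inter> (W' O W')\<inverse>" by blast
    also have "\<dots> \<subseteq> P" using * ** by blast
    finally have "(V' \<inter> W'\<inverse>) O (V' \<inter> W'\<inverse>) \<subseteq> P" .
    then show "\<exists>Q \<in> sym_uniformity \<U>. Q O Q \<subseteq> P" using mem ** by blast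
  qed
qed

lemma openin_uniformity_topology:
  assumes "quasi_uniformity_on E \<U>"
  shows "openin (uniformity_topology E \<U>) S \<longleftrightarrow> S \<subseteq> E \<and> (\<forall>x \<in> S. \<exists>V \<in> \<U>. V `` {x} \<subseteq> S)"
proof -
  note int = quasi_uniformity_onD(3)[OF assms]
  have "istopology (\<lambda>S. S \<subseteq> E \<and> (\<forall>x \<in> S. \<exists>V \<in> \<U>. V `` {x} \<subseteq> S))"
    unfolding istopology_def
  proof (intro conjI allI impI ballI)
    fix S T x
    assume S: "S \<subseteq> E \<and> (\<forall>x \<in> S. \<exists>V \<in> \<U>. V `` {x} \<subseteq> S)"
      and T: "T \<subseteq> E \<and> (\<forall>x \<in> T. \<exists>V \<in> \<U>. V `` {x} \<subseteq> T)" and x: "x \<in> S \<inter> T"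
    then obtain V W where "V \<in> \<U>" "V `` {x} \<subseteq> S" "W \<in> \<U>" "W `` {x} \<subseteq> T" by blast
    then show "\<exists>V \<in> \<U>. V `` {x} \<subseteq> S \<inter> T" using int[of V W] by blast
  next
    fix \<K> x
    assume K: "\<forall>K \<in> \<K>. K \<subseteq> E \<and> (\<forall>x \<in> K. \<exists>V \<in> \<U>. V `` {x} \<subseteq> K)" and "x \<in> \<Union>\<K>"
    then obtain K where "K \<in> \<K>" "x \<in> K" by blast
    moreover obtain V where "V \<in> \<U>" "V `` {x} \<subseteq> K" using K calculation by blast
    ultimately show "\<exists>V \<in> \<U>. V `` {x} \<subseteq> \<Union>\<K>" by blast
  qed auto
  then show ?thesis unfolding uniformity_topology_def by simp
qed

lemma topspace_uniformity_topology:
  assumes "quasi_uniformity_on E \<U>"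
  shows "topspace (uniformity_topology E \<U>) = E"
proof -
  obtain V where "V \<in> \<U>" "V \<subseteq> E \<times> E"
    using quasi_uniformity_onD(1,2)[OF assms] by blast
  then have "openin (uniformity_topology E \<U>) E"
    unfolding openin_uniformity_topology[OF assms] by blast
  then show ?thesis
    by (metis assms openin_subset openin_topspace openin_uniformity_topology subset_antisym)
qed

text \<open>The neighbourhoods of \<open>x\<close> are generated by the sets \<open>V(x)\<close>.\<close>

lemma neighbourhood_uniformity_topology:
  assumes "quasi_uniformity_on E \<U>" "x \<in> E" "N \<subseteq> E"
  shows "(\<exists>G. openin (uniformity_topology E \<U>) G \<and> x \<in> G \<and> G \<subseteq> N) \<longleftrightarrow>
         (\<exists>V \<in> \<U>. V `` {x} \<subseteq> N)"
proof
  assume "\<exists>G. openin (uniformity_topology E \<U>) G \<and> x \<in> G \<and> G \<subseteq> N"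
  then show "\<exists>V \<in> \<U>. V `` {x} \<subseteq> N"
    unfolding openin_uniformity_topology[OF assms(1)] by blast
next
  assume V: "\<exists>V \<in> \<U>. V `` {x} \<subseteq> N"
  note sub = quasi_uniformity_onD(2)[OF assms(1)] and diag = quasi_uniformity_onD(5)[OF assms(1)]
    and comp = quasi_uniformity_onD(6)[OF assms(1)]
  define G where "G = {y \<in> E. \<exists>V \<in> \<U>. V `` {y} \<subseteq> N}"
  have "\<exists>W \<in> \<U>. W `` {y} \<subseteq> G" if y: "y \<in> G" for y
  proof -
    obtain V where "V \<in> \<U>" "V `` {y} \<subseteq> N" using y unfolding G_def by blast
    moreover from this obtain W where "W \<in> \<U>" "W O W \<subseteq> V" using comp by blast
    ultimately have "W `` {y} \<subseteq> G" unfolding G_def using sub[of W] by blast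
    with \<open>W \<in> \<U>\<close> show ?thesis by blast
  qed
  then have "openin (uniformity_topology E \<U>) G"
    unfolding openin_uniformity_topology[OF assms(1)] G_def by blast
  moreover have "x \<in> G" using V assms(2) G_def by blast
  moreover have "G \<subseteq> N" using diag unfolding G_def by blast
  ultimately show "\<exists>G. openin (uniformity_topology E \<U>) G \<and> x \<in> G \<and> G \<subseteq> N" by blast
qed

end

theory Submission
  imports Defs
begin

text \<open>
  Write \<open>d(S)\<close> and \<open>i(S)\<close> for the decreasing and increasing hulls and \<open>x \<sim> y\<close> for
  \<open>x \<le> y \<le> x\<close>.

  Local convexity forces every open set to be saturated for \<open>\<sim>\<close>, since a convex set containing
  \<open>x\<close> contains all \<open>y \<sim> x\<close>. As \<open>\<sim>\<close> is a closed relation, two points that are not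
  equivalent have disjoint neighbourhoods, so the space is Hausdorff up to \<open>\<sim>\<close>, and local
  compactness provides a neighbourhood base of compact sets
  (\<open>neighbourhood_base_of_compactin\<close>).

  Both normality and convexity say that a closed decreasing set \<open>P\<close> and a closed increasing set
  \<open>Q\<close> whose intersection is small have open decreasing, respectively increasing, supersets whose
  intersection is still small: for normality \<open>P \<inter> Q = {}\<close>, for convexity at \<open>x\<close> one has
  \<open>P = d(x)\<close>, \<open>Q = i(x)\<close>, and the bound is an open set \<open>G\<close> around \<open>x\<close> whose convex hull lies
  in a compact set \<open>M\<close>. The two cases are instances of \<open>separation_sigma_compact\<close>, which treats
  \<open>P = A \<union> d(C)\<close> and \<open>Q = B \<union> i(D)\<close> with \<open>A\<close>, \<open>B\<close> closed and disjoint and \<open>C\<close>, \<open>D\<close> compact.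
  A decreasing neighbourhood of \<open>P\<close> need not contain an open decreasing one, so the open set is
  reached in countably many steps. In step \<open>n\<close> the compact set \<open>C\<close> is enlarged to a compact
  neighbourhood of \<open>C \<union> (P \<inter> K\<^sub>n)\<close>, and \<open>D\<close> likewise, where the compact sets \<open>K\<^sub>n\<close> increase
  to the whole space. Each point of \<open>P\<close> thus becomes interior sooner or later, and the union of
  all the sets \<open>P\<close> is open, although each of them is only closed. That the neighbourhoods can be
  so small that \<open>P \<inter> Q \<subseteq> G\<close> survives (\<open>separation_step\<close>) is a tube argument for the compact
  set \<open>D \<times> C\<close>.

  A convex normally preordered space is quasi-uniformizable without any real-valued functions:
  the sets \<open>{(x, y). y \<in> A \<longrightarrow> x \<in> B}\<close> with \<open>A\<close> closed decreasing, \<open>B\<close> open decreasing and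
  \<open>A \<subseteq> B\<close> form a subbase of a quasi-uniformity, because normality interpolates between
  \<open>A\<close> and \<open>B\<close> (\<open>quasi_uniformizable_convex_normally_preordered\<close>).
\<close>

section \<open>Preorders and increasing sets\<close>

lemma preorder_onD:
  assumes "preorder_on E R"
  shows "R \<subseteq> E \<times> E"
    and "x \<in> E \<Longrightarrow> (x, x) \<in> R"
    and "(x, y) \<in> R \<Longrightarrow> (y, z) \<in> R \<Longrightarrow> (x, z) \<in> R"
  using assms unfolding preorder_on_def refl_on_def by (auto dest: transD)

lemma increasing_set_iff:
  assumes "preorder_on E R"
  shows "increasing_set R S \<longleftrightarrow> S \<subseteq> E \<and> (\<forall>x y. x \<in> S \<longrightarrow> (x, y) \<in> R \<longrightarrow> y \<in> S)"
  using preorder_onD(1,2)[OF assms] unfolding increasing_set_def by blast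

lemma decreasing_set_iff:
  assumes "preorder_on E R"
  shows "decreasing_set R S \<longleftrightarrow> S \<subseteq> E \<and> (\<forall>x y. y \<in> S \<longrightarrow> (x, y) \<in> R \<longrightarrow> x \<in> S)"
  using preorder_onD(1,2)[OF assms] unfolding decreasing_set_def by blast

lemma increasing_set_Image:
  assumes "preorder_on E R"
  shows "increasing_set R (R `` S)" "decreasing_set R (R\<inverse> `` S)"
  unfolding increasing_set_iff[OF assms] decreasing_set_iff[OF assms]
  using preorder_onD(1,3)[OF assms] by blast+

lemma increasing_set_complement:
  assumes "preorder_on E R"
  shows "decreasing_set R S \<Longrightarrow> increasing_set R (E - S)"
    and "increasing_set R S \<Longrightarrow> decreasing_set R (E - S)"
  unfolding increasing_set_iff[OF assms] decreasing_set_iff[OF assms]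
  using preorder_onD(1)[OF assms] by blast+

section \<open>Closed relations and compact sets\<close>

text \<open>
  The projection along a compact factor is a closed map.
\<close>
lemma closedin_Image_compactin:
  assumes "closedin (prod_topology X Y) R" "compactin X K"
  shows "closedin Y (R `` K)"
proof -
  let ?Z = "prod_topology (subtopology X K) Y"
  have "closedin ?Z {p \<in> topspace ?Z. p \<in> R}"
  proof (rule closedin_continuous_map_preimage[OF _ assms(1)])
    show "continuous_map ?Z (prod_topology X Y) (\<lambda>p. p)"
      unfolding prod_topology_subtopology by (simp add: continuous_map_from_subtopology)
  qed
  moreover have "closed_map ?Z Y snd"
    using assms(2) by (simp add: closed_map_snd compact_space_subtopology)
  moreover have "snd ` {p \<in> topspace ?Z. p \<in> R} = R `` K"
    using closedin_subset[OF assms(1)] compactin_subset_topspace[OF assms(2)] by force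
  ultimately show ?thesis
    unfolding closed_map_def by metis
qed

lemma compactin_Diff_openin:
  assumes "compactin X K" "openin X W"
  shows "compactin X (K - W)"
proof -
  have "K - W = K \<inter> (topspace X - W)"
    using compactin_subset_topspace[OF assms(1)] by blast
  then show ?thesis
    using assms by (simp add: compact_Int_closedin closedin_diff)
qed

lemma closedin_converse:
  assumes "closedin (prod_topology X Y) R"
  shows "closedin (prod_topology Y X) (R\<inverse>)"
proof -
  have "closedin (prod_topology Y X) {p \<in> topspace (prod_topology Y X). (snd p, fst p) \<in> R}"
    by (rule closedin_continuous_map_preimage[OF _ assms])
      (simp add: continuous_map_pairedI continuous_map_fst continuous_map_snd)
  moreover have "{p \<in> topspace (prod_topology Y X). (snd p, fst p) \<in> R} = R\<inverse>"
    using closedin_subset[OF assms] by auto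
  ultimately show ?thesis by simp
qed

text \<open>
  The composition of two closed relations is closed when the intermediate point is confined to a
  compact set: it is the image of that compact set under a closed relation between \<open>Y\<close> and
  \<open>X \<times> Z\<close>.
\<close>
lemma closedin_relcomp_compactin:
  assumes P: "closedin (prod_topology X Y) P" and Q: "closedin (prod_topology Y Z) Q"
    and K: "compactin Y K"
  shows "closedin (prod_topology X Z) {(x, z). \<exists>y \<in> K. (x, y) \<in> P \<and> (y, z) \<in> Q}"
proof -
  let ?T = "prod_topology Y (prod_topology X Z)"
  have fst: "continuous_map ?T Y fst" and snd: "continuous_map ?T (prod_topology X Z) snd"
    by (simp_all add: continuous_map_fst continuous_map_snd)
  have 1: "continuous_map ?T X (fst \<circ> snd)"
    by (rule continuous_map_compose[OF snd]) (simp add: continuous_map_fst)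
  have 2: "continuous_map ?T Z (snd \<circ> snd)"
    by (rule continuous_map_compose[OF snd]) (simp add: continuous_map_snd)
  let ?A = "{p \<in> topspace ?T. (fst (snd p), fst p) \<in> P}"
  let ?B = "{p \<in> topspace ?T. (fst p, snd (snd p)) \<in> Q}"
  have "closedin ?T ?A"
    by (rule closedin_continuous_map_preimage[OF _ P])
      (use continuous_map_pairedI[OF 1 fst] in \<open>simp add: o_def\<close>)
  moreover have "closedin ?T ?B"
    by (rule closedin_continuous_map_preimage[OF _ Q])
      (use continuous_map_pairedI[OF fst 2] in \<open>simp add: o_def\<close>)
  ultimately have "closedin (prod_topology X Z) ((?A \<inter> ?B) `` K)"
    using K by (intro closedin_Image_compactin) auto
  moreover have "(?A \<inter> ?B) `` K = {(x, z). \<exists>y \<in> K. (x, y) \<in> P \<and> (y, z) \<in> Q}"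
    using closedin_subset[OF P] closedin_subset[OF Q] by auto
  ultimately show ?thesis by simp
qed

section \<open>Local convexity provides small compact neighbourhoods\<close>

lemma open_saturated:
  assumes pre: "preorder_on (topspace X) R"
    and conv: "locally_order_convex_space X R"
    and W: "openin X W" "x \<in> W" and xy: "(x, y) \<in> R" "(y, x) \<in> R"
  shows "y \<in> W"
proof -
  obtain N C where "order_convex_set R C" "x \<in> N" "N \<subseteq> C" "C \<subseteq> W"
    using conv W openin_subset[OF W(1)]
    unfolding locally_order_convex_space_def locally_order_convex_at_def neighbourhood_base_at_def
    by (metis subsetD)
  then show ?thesis
    using xy unfolding order_convex_set_def increasing_set_iff[OF pre] decreasing_set_iff[OF pre]
    by blast
qed

text \<open>
  Given a compact neighbourhood \<open>K\<close> of \<open>x\<close> and an open \<open>W\<close> around \<open>x\<close>, no point of the compact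
  set \<open>K - W\<close> is equivalent to \<open>x\<close>, as \<open>W\<close> is saturated. Equivalence is a closed relation, so
  the tube lemma separates \<open>x\<close> from \<open>K - W\<close> by disjoint open sets; removing from \<open>K\<close> the one
  around \<open>K - W\<close> leaves a compact neighbourhood of \<open>x\<close> inside \<open>W\<close>.
\<close>
lemma neighbourhood_base_of_compactin:
  assumes pre: "preorder_on (topspace X) R"
    and conv: "locally_order_convex_space X R"
    and cl: "closedin (prod_topology X X) R"
    and lc: "locally_compact_space X"
  shows "neighbourhood_base_of (compactin X) X"
  unfolding neighbourhood_base_of
proof (intro allI impI, elim conjE)
  fix W x assume W: "openin X W" "x \<in> W"
  note R = preorder_onD[OF pre]
  have x: "x \<in> topspace X" using W openin_subset by blast
  obtain U K where K: "openin X U" "compactin X K" "x \<in> U" "U \<subseteq> K"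
    using lc x unfolding locally_compact_space_def by blast
  have sat: "y \<in> W" if "(x, y) \<in> R" "(y, x) \<in> R" for y
    using open_saturated[OF pre conv W that] .
  let ?S = "R \<inter> R\<inverse>"
  have S: "closedin (prod_topology X X) ?S"
    using cl closedin_converse by blast
  have "compactin X (K - W)"
    using K(2) W(1) by (rule compactin_Diff_openin)
  moreover have "{x} \<times> (K - W) \<subseteq> topspace (prod_topology X X) - ?S"
    using x sat compactin_subset_topspace[OF K(2)] by auto
  ultimately obtain G H where GH: "openin X G" "openin X H" "{x} \<subseteq> G" "K - W \<subseteq> H"
      "G \<times> H \<subseteq> topspace (prod_topology X X) - ?S"
    using Wallace_theorem_prod_topology[of X "{x}" X "K - W" "topspace (prod_topology X X) - ?S"] x S
    by (metis compactin_sing openin_diff openin_topspace)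
  \<comment> \<open>A common point would be related to itself, against the choice of \<open>G\<close> and \<open>H\<close>.\<close>
  have "G \<inter> H = {}"
    using GH(5) R(2) openin_subset[OF GH(1)] by blast
  then have "U \<inter> G \<subseteq> K - H" "K - H \<subseteq> W" "x \<in> U \<inter> G"
    using K GH by blast+
  moreover have "compactin X (K - H)"
    using K(2) GH(2) by (rule compactin_Diff_openin)
  moreover have "openin X (U \<inter> G)" using K GH by blast
  ultimately show "\<exists>U V. openin X U \<and> compactin X V \<and> x \<in> U \<and> U \<subseteq> V \<and> V \<subseteq> W"
    by blast
qed

lemma compactin_neighbourhood_between:
  assumes base: "neighbourhood_base_of (compactin X) X"
    and K: "compactin X K" and W: "openin X W" "K \<subseteq> W"
  obtains U C where "openin X U" "compactin X C" "K \<subseteq> U" "U \<subseteq> C" "C \<subseteq> W"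
proof -
  have "\<exists>U C. openin X U \<and> compactin X C \<and> x \<in> U \<and> U \<subseteq> C \<and> C \<subseteq> W" if "x \<in> K" for x
    using base W that unfolding neighbourhood_base_of by blast
  then obtain u c where uc: "\<And>x. x \<in> K \<Longrightarrow>
      openin X (u x) \<and> compactin X (c x) \<and> x \<in> u x \<and> u x \<subseteq> c x \<and> c x \<subseteq> W"
    by metis
  have "\<forall>V \<in> u ` K. openin X V" "K \<subseteq> \<Union>(u ` K)"
    using uc by blast+
  then obtain \<F> where "finite \<F>" "\<F> \<subseteq> u ` K" "K \<subseteq> \<Union>\<F>"
    using K unfolding compactin_def by metis
  then obtain F where F: "finite F" "F \<subseteq> K" "K \<subseteq> \<Union>(u ` F)"
    by (metis finite_subset_image)
  show thesis
  proof (rule that)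
    show "openin X (\<Union>(u ` F))" using F uc by blast
    show "compactin X (\<Union>(c ` F))" using F uc by (intro compactin_Union) auto
    show "\<Union>(u ` F) \<subseteq> \<Union>(c ` F)" "\<Union>(c ` F) \<subseteq> W" using F uc by blast+
  qed (fact F)
qed

section \<open>Separation by open decreasing and increasing sets\<close>

text \<open>
  A single enlargement. Replacing \<open>C\<close> by \<open>C \<union> ((A \<union> d(C)) \<inter> K)\<close>, and \<open>D\<close> similarly, adds
  nothing to \<open>A \<union> d(C)\<close> and hence preserves \<open>d(C) \<inter> i(D) \<subseteq> G\<close>; it remains to thicken these
  compact sets slightly. The inclusion \<open>d(C) \<inter> i(D) \<subseteq> G\<close> is a condition on all \<open>d \<le> z \<le> c\<close>
  with \<open>d \<in> D\<close>, \<open>c \<in> C\<close>, in which \<open>z\<close> ranges over a noncompact space, so that it is not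
  obviously open in \<open>(d, c)\<close>. The set \<open>M\<close> cures this: if \<open>d \<le> c\<close> implies \<open>d, c \<in> G\<close>, which is
  an open condition on \<open>(d, c)\<close>, then \<open>z\<close> lies in \<open>M\<close>, and no \<open>z\<close> in the compact set
  \<open>M - G\<close> being between \<open>d\<close> and \<open>c\<close> is an open condition as well.
\<close>
lemma separation_step:
  assumes pre: "preorder_on (topspace X) R"
    and cl: "closedin (prod_topology X X) R"
    and base: "neighbourhood_base_of (compactin X) X"
    and A: "closedin X A" "decreasing_set R A" and B: "closedin X B" "increasing_set R B"
    and AB: "A \<inter> B = {}"
    and G: "openin X G" and M: "compactin X M" and GM: "R `` G \<inter> R\<inverse> `` G \<subseteq> M"
    and K: "compactin X K"
    and C: "compactin X C" "C \<inter> B = {}" and D: "compactin X D" "D \<inter> A = {}"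
    and CD: "R\<inverse> `` C \<inter> R `` D \<subseteq> G"
  obtains C' D' U V where
    "compactin X C'" "C' \<inter> B = {}" "compactin X D'" "D' \<inter> A = {}"
    "R\<inverse> `` C' \<inter> R `` D' \<subseteq> G" "C \<subseteq> C'" "D \<subseteq> D'"
    "openin X U" "(A \<union> R\<inverse> `` C) \<inter> K \<subseteq> U" "U \<subseteq> C'"
    "openin X V" "(B \<union> R `` D) \<inter> K \<subseteq> V" "V \<subseteq> D'"
proof -
  note R = preorder_onD[OF pre]
  note A' = A(2)[unfolded decreasing_set_iff[OF pre]]
  note B' = B(2)[unfolded increasing_set_iff[OF pre]]
  let ?E = "topspace X"
  let ?C = "C \<union> (A \<union> R\<inverse> `` C) \<inter> K" and ?D = "D \<union> (B \<union> R `` D) \<inter> K"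
  have "closedin X (A \<union> R\<inverse> `` C)" "closedin X (B \<union> R `` D)"
    using A(1) B(1) cl C(1) D(1) by (auto intro: closedin_Image_compactin closedin_converse)
  then have comp: "compactin X ?C" "compactin X ?D"
    using C(1) D(1) K by (auto intro!: compactin_Un closed_Int_compactin)
  have CB: "?C \<inter> B = {}" and DA: "?D \<inter> A = {}"
    using AB A' B' C(2) D(2) by blast+
  have CD0: "R\<inverse> `` ?C \<inter> R `` ?D \<subseteq> G"
  proof
    fix z assume "z \<in> R\<inverse> `` ?C \<inter> R `` ?D"
    then have "z \<in> A \<union> R\<inverse> `` C" "z \<in> B \<union> R `` D"
      using A' B' R(3) by blast+
    then show "z \<in> G" using AB A' B' C(2) D(2) CD by blast
  qed
  \<comment> \<open>The pairs in \<open>?W\<close> are those that satisfy both open conditions.\<close>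
  let ?T = "{(d, c). \<exists>z \<in> M - G. (d, z) \<in> R \<and> (z, c) \<in> R}"
  let ?W = "((?E \<times> ?E - R) \<union> G \<times> G) - ?T"
  have "compactin X (M - G)"
    using M G by (rule compactin_Diff_openin)
  then have "closedin (prod_topology X X) ?T"
    using cl by (intro closedin_relcomp_compactin)
  moreover have "openin (prod_topology X X) (?E \<times> ?E - R)"
    using cl by (metis openin_diff openin_topspace topspace_prod_topology)
  moreover have "openin (prod_topology X X) (G \<times> G)"
    using G by (simp add: openin_prod_Times_iff)
  ultimately have W: "openin (prod_topology X X) ?W"
    by (simp only: openin_diff openin_Un)
  have DC: "?D \<times> ?C \<subseteq> ?W"
  proof clarify
    fix d c assume dc: "d \<in> ?D" "c \<in> ?C"
    have E: "d \<in> ?E" "c \<in> ?E"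
      using dc comp compactin_subset_topspace by blast+
    \<comment> \<open>If \<open>d \<le> c\<close>, then both points lie between \<open>d\<close> and \<open>c\<close>.\<close>
    have "d \<in> G \<and> c \<in> G" if "(d, c) \<in> R"
    proof -
      have "d \<in> R\<inverse> `` ?C \<inter> R `` ?D" "c \<in> R\<inverse> `` ?C \<inter> R `` ?D"
        using that dc R(2) E by blast+
      then show ?thesis using CD0 by blast
    qed
    moreover have "(d, c) \<notin> ?T"
      using CD0 dc by blast
    ultimately show "(d, c) \<in> ?W" using E by blast
  qed
  obtain N\<^sub>D N\<^sub>C where N: "openin X N\<^sub>D" "openin X N\<^sub>C" "?D \<subseteq> N\<^sub>D" "?C \<subseteq> N\<^sub>C"
      "N\<^sub>D \<times> N\<^sub>C \<subseteq> ?W"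
    by (rule Wallace_theorem_prod_topology[OF comp(2,1) W DC])
  obtain U C' where U: "openin X U" "compactin X C'" "?C \<subseteq> U" "U \<subseteq> C'" "C' \<subseteq> N\<^sub>C - B"
  proof (rule compactin_neighbourhood_between[OF base comp(1)])
    show "openin X (N\<^sub>C - B)" using N(2) B(1) by (rule openin_diff)
    show "?C \<subseteq> N\<^sub>C - B" using N(4) CB by blast
  qed
  obtain V D' where V: "openin X V" "compactin X D'" "?D \<subseteq> V" "V \<subseteq> D'" "D' \<subseteq> N\<^sub>D - A"
  proof (rule compactin_neighbourhood_between[OF base comp(2)])
    show "openin X (N\<^sub>D - A)" using N(1) A(1) by (rule openin_diff)
    show "?D \<subseteq> N\<^sub>D - A" using N(3) DA by blast
  qed
  have "R\<inverse> `` C' \<inter> R `` D' \<subseteq> G"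
  proof clarify
    fix z d c assume dzc: "c \<in> C'" "(z, c) \<in> R" "d \<in> D'" "(d, z) \<in> R"
    then have "(d, c) \<in> N\<^sub>D \<times> N\<^sub>C" using U(5) V(5) by blast
    with N(5) have dc: "(d, c) \<in> ?W" by (rule subsetD)
    have "(d, c) \<in> R" using dzc R(3) by blast
    with dc have "d \<in> G" "c \<in> G" by blast+
    then have "z \<in> M" using GM dzc by blast
    then show "z \<in> G" using dc dzc by blast
  qed
  then show thesis
    using that[of C' D' U V] U V by blast
qed

text \<open>
  A point of \<open>F m \<inter> K n\<close> lies in \<open>F k \<inter> K k\<close> for \<open>k = max m n\<close>, hence in the interior of the next
  set.
\<close>
lemma openin_UN_exhaustion:
  fixes K F :: "nat \<Rightarrow> 'a set"
  assumes K_mono: "\<And>m n. m \<le> n \<Longrightarrow> K m \<subseteq> K n"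
    and K_cover: "\<And>x. x \<in> topspace X \<Longrightarrow> \<exists>n. x \<in> K n"
    and F_mono: "\<And>m n. m \<le> n \<Longrightarrow> F m \<subseteq> F n"
    and F_sub: "\<And>n. F n \<subseteq> topspace X"
    and F_step: "\<And>n. \<exists>U. openin X U \<and> F n \<inter> K n \<subseteq> U \<and> U \<subseteq> F (Suc n)"
  shows "openin X (\<Union>n. F n)"
proof (subst openin_subopen, intro ballI)
  fix x assume "x \<in> (\<Union>n. F n)"
  then obtain m where m: "x \<in> F m" by blast
  then obtain n where n: "x \<in> K n"
    using K_cover F_sub by blast
  obtain U where U: "openin X U" "F (max m n) \<inter> K (max m n) \<subseteq> U" "U \<subseteq> F (Suc (max m n))"
    using F_step by blast
  have "x \<in> U"
    using U(2) m n F_mono[of m "max m n"] K_mono[of n "max m n"] by auto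
  then show "\<exists>T. openin X T \<and> x \<in> T \<and> T \<subseteq> (\<Union>n. F n)"
    using U by blast
qed

text \<open>
  Iterating the enlargement along an exhaustion by compact sets. The sets \<open>A\<close>, \<open>B\<close> stay fixed and
  only the compact generators \<open>C\<close>, \<open>D\<close> grow. Normality is the case in which \<open>C\<close>, \<open>D\<close>, \<open>G\<close> and
  \<open>M\<close> are empty, convexity the case in which \<open>A\<close> and \<open>B\<close> are empty.
\<close>
lemma separation_sigma_compact:
  assumes pre: "preorder_on (topspace X) R"
    and cl: "closedin (prod_topology X X) R"
    and base: "neighbourhood_base_of (compactin X) X"
    and \<sigma>: "sigma_compact_space X"
    and A: "closedin X A" "decreasing_set R A" and B: "closedin X B" "increasing_set R B"
    and AB: "A \<inter> B = {}"
    and G: "openin X G" and M: "compactin X M" and GM: "R `` G \<inter> R\<inverse> `` G \<subseteq> M"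
    and C: "compactin X C" "C \<inter> B = {}" and D: "compactin X D" "D \<inter> A = {}"
    and CD: "R\<inverse> `` C \<inter> R `` D \<subseteq> G"
  obtains U V where "openin X U" "decreasing_set R U" "A \<union> C \<subseteq> U"
    "openin X V" "increasing_set R V" "B \<union> D \<subseteq> V" "U \<inter> V \<subseteq> G"
proof -
  note R = preorder_onD[OF pre]
  note A' = A(2)[unfolded decreasing_set_iff[OF pre]]
  note B' = B(2)[unfolded increasing_set_iff[OF pre]]
  obtain \<K> where \<K>: "countable \<K>" "\<forall>K \<in> \<K>. compactin X K" "\<Union>\<K> = topspace X"
    using \<sigma> unfolding sigma_compact_space_def by metis
  \<comment> \<open>Inserting the empty set allows an enumeration even when \<open>\<K>\<close> is empty.\<close>
  define L where "L = from_nat_into (insert {} \<K>)"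
  have L: "range L = insert {} \<K>"
    unfolding L_def using \<K>(1) by (simp add: range_from_nat_into)
  define K where "K n = (\<Union>i\<le>n. L i)" for n :: nat
  have K: "compactin X (K n)" for n
  proof -
    have "compactin X (L i)" for i
      using L \<K>(2) rangeI[of L i] by (auto simp: finite_imp_compactin)
    then show ?thesis unfolding K_def by (intro compactin_Union) auto
  qed
  have K_mono: "K m \<subseteq> K n" if "m \<le> n" for m n
    unfolding K_def using that by force
  have K_cover: "\<exists>n. x \<in> K n" if "x \<in> topspace X" for x
  proof -
    have "x \<in> \<Union>(range L)"
      using that \<K>(3) unfolding L by simp
    then show ?thesis unfolding K_def by blast
  qed
  \<comment> \<open>The state of the iteration is the pair of compact generators.\<close>
  define good where "good p \<longleftrightarrow> C \<subseteq> fst p \<and> D \<subseteq> snd p \<and> compactin X (fst p) \<and> fst p \<inter> B = {} \<and>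
      compactin X (snd p) \<and> snd p \<inter> A = {} \<and> R\<inverse> `` fst p \<inter> R `` snd p \<subseteq> G" for p
  define down where "down p = A \<union> R\<inverse> `` fst p" for p :: "'a set \<times> 'a set"
  define up where "up p = B \<union> R `` snd p" for p :: "'a set \<times> 'a set"
  define next_to where "next_to n p q \<longleftrightarrow> fst p \<subseteq> fst q \<and> snd p \<subseteq> snd q \<and>
      (\<exists>U. openin X U \<and> down p \<inter> K n \<subseteq> U \<and> U \<subseteq> fst q) \<and>
      (\<exists>V. openin X V \<and> up p \<inter> K n \<subseteq> V \<and> V \<subseteq> snd q)" for n p q
  have "\<exists>f. \<forall>n. good (f n) \<and> next_to n (f n) (f (Suc n))"
  proof (rule dependent_nat_choice)
    show "\<exists>p. good p"
      using C D CD unfolding good_def by (intro exI[of _ "(C, D)"]) auto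
  next
    fix p n assume p: "good p"
    have "compactin X (fst p)" "fst p \<inter> B = {}" "compactin X (snd p)" "snd p \<inter> A = {}"
      "R\<inverse> `` fst p \<inter> R `` snd p \<subseteq> G"
      using p unfolding good_def by blast+
    from separation_step[OF pre cl base A B AB G M GM K[of n] this]
    obtain C' D' U V where
      "compactin X C'" "C' \<inter> B = {}" "compactin X D'" "D' \<inter> A = {}"
      "R\<inverse> `` C' \<inter> R `` D' \<subseteq> G" "fst p \<subseteq> C'" "snd p \<subseteq> D'"
      "openin X U" "down p \<inter> K n \<subseteq> U" "U \<subseteq> C'"
      "openin X V" "up p \<inter> K n \<subseteq> V" "V \<subseteq> D'"
      unfolding down_def up_def .
    then show "\<exists>q. good q \<and> next_to n p q"
      using p unfolding good_def next_to_def by (intro exI[of _ "(C', D')"]) auto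
  qed
  then obtain f where good: "\<And>n. good (f n)" and f_next: "\<And>n. next_to n (f n) (f (Suc n))"
    by blast
  have "down (f n) \<subseteq> down (f (Suc n))" "up (f n) \<subseteq> up (f (Suc n))" for n
    using f_next[of n] unfolding next_to_def down_def up_def by blast+
  then have mono: "down (f m) \<subseteq> down (f n)" "up (f m) \<subseteq> up (f n)" if "m \<le> n" for m n
    using that lift_Suc_mono_le[of "\<lambda>n. down (f n)"] lift_Suc_mono_le[of "\<lambda>n. up (f n)"] by blast+
  have in_E: "fst (f n) \<subseteq> topspace X" "snd (f n) \<subseteq> topspace X" for n
    using good[of n] compactin_subset_topspace unfolding good_def by blast+
  have refl: "fst (f n) \<subseteq> down (f n)" "snd (f n) \<subseteq> up (f n)" for n
    using in_E R(2) unfolding down_def up_def by blast+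
  have dec: "decreasing_set R (down (f n))" and inc: "increasing_set R (up (f n))" for n
    using A(2) B(2) increasing_set_Image[OF pre] unfolding down_def up_def
      increasing_set_def decreasing_set_def by (simp_all add: Image_Un)
  have meet: "down (f n) \<inter> up (f n) \<subseteq> G" for n
  proof -
    have "fst (f n) \<inter> B = {}" "snd (f n) \<inter> A = {}" "R\<inverse> `` fst (f n) \<inter> R `` snd (f n) \<subseteq> G"
      using good[of n] unfolding good_def by simp_all
    then show ?thesis
      using AB A' B' unfolding down_def up_def by blast
  qed
  show thesis
  proof (rule that)
    let ?U = "\<Union>n. down (f n)" and ?V = "\<Union>n. up (f n)"
    show "openin X ?U"
    proof (rule openin_UN_exhaustion[OF K_mono K_cover mono(1)])
      fix n
      show "down (f n) \<subseteq> topspace X"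
        using dec[of n] unfolding decreasing_set_iff[OF pre] by (rule conjunct1)
      show "\<exists>U. openin X U \<and> down (f n) \<inter> K n \<subseteq> U \<and> U \<subseteq> down (f (Suc n))"
        using f_next[of n] refl(1)[of "Suc n"] unfolding next_to_def by (meson order_trans)
    qed
    show "openin X ?V"
    proof (rule openin_UN_exhaustion[OF K_mono K_cover mono(2)])
      fix n
      show "up (f n) \<subseteq> topspace X"
        using inc[of n] unfolding increasing_set_iff[OF pre] by (rule conjunct1)
      show "\<exists>V. openin X V \<and> up (f n) \<inter> K n \<subseteq> V \<and> V \<subseteq> up (f (Suc n))"
        using f_next[of n] refl(2)[of "Suc n"] unfolding next_to_def by (meson order_trans)
    qed
    show "decreasing_set R ?U" "increasing_set R ?V"
      using dec inc unfolding decreasing_set_def increasing_set_def by (simp_all add: Image_UN)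
    have "A \<subseteq> down (f 0)" "B \<subseteq> up (f 0)"
      unfolding down_def up_def by blast+
    moreover have "C \<subseteq> down (f 0)" "D \<subseteq> up (f 0)"
      using good[of 0] refl[of 0] unfolding good_def by (meson order_trans)+
    ultimately show "A \<union> C \<subseteq> ?U" "B \<union> D \<subseteq> ?V"
      by blast+
    show "?U \<inter> ?V \<subseteq> G"
    proof clarify
      fix z m n assume "z \<in> down (f m)" "z \<in> up (f n)"
      then have "z \<in> down (f (max m n))" "z \<in> up (f (max m n))"
        using mono[of m "max m n"] mono[of n "max m n"] by auto
      then show "z \<in> G"
        using meet by blast
    qed
  qed
qed

lemma normally_preordered_sigma_compact:
  assumes pre: "preorder_on (topspace X) R"
    and cl: "closedin (prod_topology X X) R"
    and base: "neighbourhood_base_of (compactin X) X"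
    and \<sigma>: "sigma_compact_space X"
  shows "normally_preordered X R"
  unfolding normally_preordered_def T1_preordered_def
proof (intro conjI ballI allI impI, goal_cases)
  case (1 x)
  then show ?case using cl by (intro closedin_Image_compactin) auto
next
  case (2 x)
  then show ?case using cl by (intro closedin_Image_compactin closedin_converse) auto
next
  case (3 A B)
  then obtain U V where "openin X U" "decreasing_set R U" "A \<union> {} \<subseteq> U"
      "openin X V" "increasing_set R V" "B \<union> {} \<subseteq> V" "U \<inter> V \<subseteq> {}"
    using separation_sigma_compact[OF pre cl base \<sigma>, of A B "{}" "{}" "{}" "{}"] by auto
  then show ?case by blast
qed

text \<open>
  Convexity at \<open>x\<close> applies the separation to \<open>d(x)\<close> and \<open>i(x)\<close>. Local convexity enters twice: it
  puts \<open>d(x) \<inter> i(x)\<close>, the class of \<open>x\<close>, into every open set around \<open>x\<close>, and it yields an open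
  \<open>G\<close> around \<open>x\<close> whose convex hull lies in a compact subset of the given neighbourhood.
\<close>
lemma order_convex_space_sigma_compact:
  assumes pre: "preorder_on (topspace X) R"
    and cl: "closedin (prod_topology X X) R"
    and conv: "locally_order_convex_space X R"
    and base: "neighbourhood_base_of (compactin X) X"
    and \<sigma>: "sigma_compact_space X"
  shows "order_convex_space X R"
  unfolding order_convex_space_def order_convex_at_def
proof (intro ballI allI impI, elim conjE)
  fix x W assume x: "x \<in> topspace X" and W: "openin X W" "x \<in> W"
  obtain N M where M: "openin X N" "compactin X M" "x \<in> N" "N \<subseteq> M" "M \<subseteq> W"
    using base W unfolding neighbourhood_base_of by metis
  obtain G C where G: "openin X G" "order_convex_set R C" "x \<in> G" "G \<subseteq> C" "C \<subseteq> N"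
    using conv x M(1,3)
    unfolding locally_order_convex_space_def locally_order_convex_at_def neighbourhood_base_at_def
    by metis
  from G(2) have "R `` C \<inter> R\<inverse> `` C \<subseteq> C"
    unfolding order_convex_set_def increasing_set_iff[OF pre] decreasing_set_iff[OF pre] by blast
  then have hull: "R `` G \<inter> R\<inverse> `` G \<subseteq> M"
    using G(4,5) M(4) by blast
  have self: "R\<inverse> `` {x} \<inter> R `` {x} \<subseteq> G"
    using open_saturated[OF pre conv G(1,3)] by blast
  have "compactin X {x}" "decreasing_set R {}" "increasing_set R {}"
    using x unfolding increasing_set_def decreasing_set_def by simp_all
  then obtain U V where "openin X U" "decreasing_set R U" "{} \<union> {x} \<subseteq> U"
      "openin X V" "increasing_set R V" "{} \<union> {x} \<subseteq> V" "U \<inter> V \<subseteq> G"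
    using separation_sigma_compact[OF pre cl base \<sigma> closedin_empty _ closedin_empty _ Int_empty_left
        G(1) M(2) hull _ Int_empty_right _ Int_empty_right self] by metis
  moreover have "G \<subseteq> W" using G M by blast
  ultimately show "\<exists>U V. openin X U \<and> decreasing_set R U \<and> openin X V \<and> increasing_set R V \<and>
      x \<in> U \<inter> V \<and> U \<inter> V \<subseteq> W"
    by blast
qed

section \<open>The quasi-uniformity of a convex normally preordered space\<close>

text \<open>
  The factor \<open>E \<times> E\<close> turns the intersection of the empty family, which is the whole type, into
  the largest entourage.
\<close>
lemma quasi_uniformity_on_subbase:
  assumes sub: "\<And>V. V \<in> \<S> \<Longrightarrow> Id_on E \<subseteq> V"
    and comp: "\<And>V. V \<in> \<S> \<Longrightarrow>
      \<exists>\<F>. finite \<F> \<and> \<F> \<subseteq> \<S> \<and> (E \<times> E \<inter> \<Inter>\<F>) O (E \<times> E \<inter> \<Inter>\<F>) \<subseteq> V"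
  shows "quasi_uniformity_on E {V. V \<subseteq> E \<times> E \<and> (\<exists>\<F>. finite \<F> \<and> \<F> \<subseteq> \<S> \<and> E \<times> E \<inter> \<Inter>\<F> \<subseteq> V)}"
  unfolding quasi_uniformity_on_def
proof (intro conjI ballI allI impI, goal_cases)
  case 1
  have "E \<times> E \<inter> \<Inter>{} \<subseteq> E \<times> E" by blast
  then show ?case by blast
next
  case (2 V)
  then show ?case by blast
next
  case (3 V W)
  then obtain \<F> \<G> where "finite \<F>" "\<F> \<subseteq> \<S>" "E \<times> E \<inter> \<Inter>\<F> \<subseteq> V"
    "finite \<G>" "\<G> \<subseteq> \<S>" "E \<times> E \<inter> \<Inter>\<G> \<subseteq> W" by blast
  then have "finite (\<F> \<union> \<G>)" "\<F> \<union> \<G> \<subseteq> \<S>" "E \<times> E \<inter> \<Inter>(\<F> \<union> \<G>) \<subseteq> V \<inter> W" by auto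
  with 3 show ?case by blast
next
  case (4 V W)
  then obtain \<F> where "finite \<F>" "\<F> \<subseteq> \<S>" "E \<times> E \<inter> \<Inter>\<F> \<subseteq> V" "V \<subseteq> W" "W \<subseteq> E \<times> E"
    by blast
  then show ?case by (intro CollectI conjI exI[of _ \<F>]) auto
next
  case (5 V)
  then show ?case using sub by blast
next
  case (6 V)
  then obtain \<F> where \<F>: "finite \<F>" "\<F> \<subseteq> \<S>" "E \<times> E \<inter> \<Inter>\<F> \<subseteq> V" "V \<subseteq> E \<times> E" by blast
  obtain g where g: "\<And>U. U \<in> \<F> \<Longrightarrow>
      finite (g U) \<and> g U \<subseteq> \<S> \<and> (E \<times> E \<inter> \<Inter>(g U)) O (E \<times> E \<inter> \<Inter>(g U)) \<subseteq> U"
    using comp \<F>(2) by (metis subsetD)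
  define W where "W = E \<times> E \<inter> \<Inter>(\<Union>(g ` \<F>))"
  have "W O W \<subseteq> U" if "U \<in> \<F>" for U
  proof -
    have "W O W \<subseteq> (E \<times> E \<inter> \<Inter>(g U)) O (E \<times> E \<inter> \<Inter>(g U))"
      using that unfolding W_def by (intro relcomp_mono) blast+
    then show ?thesis using g[OF that] by blast
  qed
  moreover have "W O W \<subseteq> E \<times> E" unfolding W_def by blast
  ultimately have "W O W \<subseteq> V" using \<F>(3) by (meson Int_greatest Inter_greatest order_trans)
  have "finite (\<Union>(g ` \<F>))" "\<Union>(g ` \<F>) \<subseteq> \<S>" using g \<F>(1) by blast+
  then have "W \<in> {V. V \<subseteq> E \<times> E \<and> (\<exists>\<F>. finite \<F> \<and> \<F> \<subseteq> \<S> \<and> E \<times> E \<inter> \<Inter>\<F> \<subseteq> V)}"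
    unfolding W_def by (intro CollectI conjI exI[of _ "\<Union>(g ` \<F>)"]) auto
  with \<open>W O W \<subseteq> V\<close> show ?case by blast
qed

definition separating_entourage :: "'a set \<Rightarrow> 'a set \<Rightarrow> 'a set \<Rightarrow> ('a \<times> 'a) set" where
  "separating_entourage E A B = {(x, y) \<in> E \<times> E. y \<in> A \<longrightarrow> x \<in> B}"

text \<open>
  Normality gives \<open>A \<subseteq> S \<subseteq> F \<subseteq> B\<close> with \<open>S\<close> open and \<open>F\<close> closed, both decreasing, and the
  entourages of \<open>(A, S)\<close> and \<open>(F, B)\<close> together compose into that of \<open>(A, B)\<close>. The
  entourages of \<open>(d(x), U)\<close> and \<open>(E - V, E - i(x))\<close>, the first inverted, confine the points
  near \<open>x\<close> to \<open>U \<inter> V\<close>, so that convexity recovers the topology; that of \<open>(d(y), E - i(x))\<close>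
  excludes a pair \<open>(x, y)\<close> outside the preorder.
\<close>
lemma quasi_uniformizable_convex_normally_preordered:
  assumes pre: "preorder_on (topspace X) R"
    and conv: "order_convex_space X R"
    and norm: "normally_preordered X R"
  shows "quasi_uniformizable X R"
proof -
  note R = preorder_onD[OF pre]
  let ?E = "topspace X"
  let ?ent = "separating_entourage ?E"
  define \<S> where "\<S> = {?ent A B | A B. closedin X A \<and> decreasing_set R A \<and>
      openin X B \<and> decreasing_set R B \<and> A \<subseteq> B}"
  define \<U> where "\<U> = {V. V \<subseteq> ?E \<times> ?E \<and> (\<exists>\<F>. finite \<F> \<and> \<F> \<subseteq> \<S> \<and> ?E \<times> ?E \<inter> \<Inter>\<F> \<subseteq> V)}"
  have ent_in: "?ent A B \<in> \<S>" if "closedin X A" "decreasing_set R A" "openin X B"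
    "decreasing_set R B" "A \<subseteq> B" for A B
    using that unfolding \<S>_def by blast
  have \<S>_sub: "V \<subseteq> ?E \<times> ?E" "R \<subseteq> V" if "V \<in> \<S>" for V
    using that R(1) unfolding \<S>_def separating_entourage_def decreasing_set_iff[OF pre] by blast+
  have \<S>_\<U>: "V \<in> \<U>" if "V \<in> \<S>" for V
    using that \<S>_sub(1)[OF that] unfolding \<U>_def by (intro CollectI conjI exI[of _ "{V}"]) auto
  have qu: "quasi_uniformity_on ?E \<U>"
    unfolding \<U>_def
  proof (rule quasi_uniformity_on_subbase)
    fix V assume V: "V \<in> \<S>"
    show "Id_on ?E \<subseteq> V" using \<S>_sub(2)[OF V] R(2) by blast
    obtain A B where AB: "V = ?ent A B" "closedin X A" "decreasing_set R A"
        "openin X B" "decreasing_set R B" "A \<subseteq> B"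
      using V unfolding \<S>_def by blast
    have "closedin X (?E - B)" "increasing_set R (?E - B)" "A \<inter> (?E - B) = {}"
      using AB increasing_set_complement(1)[OF pre] by auto
    then obtain S T where ST: "openin X S" "decreasing_set R S" "A \<subseteq> S"
        "openin X T" "increasing_set R T" "?E - B \<subseteq> T" "S \<inter> T = {}"
      using norm AB unfolding normally_preordered_def by metis
    let ?F = "{?ent A S, ?ent (?E - T) B}"
    have "?F \<subseteq> \<S>"
      using AB ST increasing_set_complement(2)[OF pre] by (auto intro!: ent_in)
    moreover have "(?E \<times> ?E \<inter> \<Inter>?F) O (?E \<times> ?E \<inter> \<Inter>?F) \<subseteq> V"
      using AB(1) ST(7) unfolding separating_entourage_def by auto
    ultimately show "\<exists>\<F>. finite \<F> \<and> \<F> \<subseteq> \<S> \<and> (?E \<times> ?E \<inter> \<Inter>\<F>) O (?E \<times> ?E \<inter> \<Inter>\<F>) \<subseteq> V"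
      by (intro exI[of _ ?F]) auto
  qed
  note sym = quasi_uniformity_on_sym_uniformity[OF qu]
  have closed: "closedin X (R `` {x})" "closedin X (R\<inverse> `` {x})" if "x \<in> ?E" for x
    using norm that unfolding normally_preordered_def T1_preordered_def by blast+
  have nbhd_sub: "\<exists>N. openin X N \<and> x \<in> N \<and> (\<forall>y \<in> N. (x, y) \<in> V \<and> (y, x) \<in> V)"
    if V: "V \<in> \<S>" and x: "x \<in> ?E" for V x
  proof -
    obtain A B where AB: "V = ?ent A B" "closedin X A" "openin X B" "A \<subseteq> B"
      using V unfolding \<S>_def by blast
    \<comment> \<open>The first factor takes care of \<open>(x, y)\<close> and the second one of \<open>(y, x)\<close>.\<close>
    let ?N = "(if x \<in> B then ?E else ?E - A) \<inter> (if x \<in> A then B else ?E)"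
    have "openin X ?N" using AB by (auto intro!: openin_Int openin_diff)
    moreover have "x \<in> ?N" using AB x by auto
    moreover have "\<forall>y \<in> ?N. (x, y) \<in> V \<and> (y, x) \<in> V"
      using AB(1) x openin_subset[OF \<open>openin X ?N\<close>]
      unfolding separating_entourage_def by (auto split: if_splits)
    ultimately show ?thesis by blast
  qed
  have nbhd: "\<exists>N. openin X N \<and> x \<in> N \<and> (\<forall>y \<in> N. (x, y) \<in> V \<and> (y, x) \<in> V)"
    if V: "V \<in> \<U>" and x: "x \<in> ?E" for V x
  proof -
    obtain \<F> where \<F>: "finite \<F>" "\<F> \<subseteq> \<S>" "?E \<times> ?E \<inter> \<Inter>\<F> \<subseteq> V"
      using V unfolding \<U>_def by blast
    obtain n where n: "\<And>P. P \<in> \<F> \<Longrightarrow>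
        openin X (n P) \<and> x \<in> n P \<and> (\<forall>y \<in> n P. (x, y) \<in> P \<and> (y, x) \<in> P)"
      using nbhd_sub[OF _ x] \<F>(2) by (metis subsetD)
    let ?N = "?E \<inter> \<Inter>(n ` \<F>)"
    have "openin X ?N"
      using \<F>(1) n by (cases "\<F> = {}") (auto intro!: openin_Int openin_Inter)
    moreover have "(x, y) \<in> V \<and> (y, x) \<in> V" if "y \<in> ?N" for y
      using that n \<F>(3) x by blast
    ultimately show ?thesis using x n by (intro exI[of _ ?N]) blast
  qed
  have "X = uniformity_topology ?E (sym_uniformity \<U>)"
    unfolding topology_eq openin_uniformity_topology[OF sym]
  proof (intro allI iffI conjI ballI)
    fix S assume S: "openin X S"
    then show "S \<subseteq> ?E" by (rule openin_subset)
    fix x assume x: "x \<in> S"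
    then have xE: "x \<in> ?E" using \<open>S \<subseteq> ?E\<close> by blast
    obtain U V where UV: "openin X U" "decreasing_set R U" "openin X V" "increasing_set R V"
        "x \<in> U \<inter> V" "U \<inter> V \<subseteq> S"
      using conv S x xE unfolding order_convex_space_def order_convex_at_def by meson
    let ?P = "?ent (R\<inverse> `` {x}) U" and ?Q = "?ent (?E - V) (?E - R `` {x})"
    have "R\<inverse> `` {x} \<subseteq> U" "R `` {x} \<subseteq> V"
      using UV unfolding increasing_set_iff[OF pre] decreasing_set_iff[OF pre] by blast+
    then have "?P \<in> \<S>" "?Q \<in> \<S>"
      using UV closed[OF xE] increasing_set_Image[OF pre] increasing_set_complement(2)[OF pre]
      by (auto intro!: ent_in)
    then have "?Q \<inter> ?P\<inverse> \<in> sym_uniformity \<U>"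
      using \<S>_\<U> unfolding sym_uniformity_def by blast
    moreover have "(?Q \<inter> ?P\<inverse>) `` {x} \<subseteq> S"
      using UV(6) R(2)[OF xE] unfolding separating_entourage_def by blast
    ultimately show "\<exists>W \<in> sym_uniformity \<U>. W `` {x} \<subseteq> S" by blast
  next
    fix S assume S: "S \<subseteq> ?E \<and> (\<forall>x \<in> S. \<exists>V \<in> sym_uniformity \<U>. V `` {x} \<subseteq> S)"
    show "openin X S"
    proof (subst openin_subopen, intro ballI)
      fix x assume x: "x \<in> S"
      then obtain P Q where PQ: "P \<in> \<U>" "Q \<in> \<U>" "(P \<inter> Q\<inverse>) `` {x} \<subseteq> S"
        using S unfolding sym_uniformity_def by blast
      have "P \<inter> Q \<in> \<U>" "x \<in> ?E"
        using quasi_uniformity_onD(3)[OF qu PQ(1,2)] x S by blast+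
      from nbhd[OF this] show "\<exists>T. openin X T \<and> x \<in> T \<and> T \<subseteq> S"
        using PQ(3) by blast
    qed
  qed
  moreover have "R = \<Inter>\<U>"
  proof
    show "R \<subseteq> \<Inter>\<U>"
      using \<S>_sub(2) R(1) unfolding \<U>_def by blast
    show "\<Inter>\<U> \<subseteq> R"
    proof clarify
      fix x y assume xy: "(x, y) \<in> \<Inter>\<U>"
      then have E: "x \<in> ?E" "y \<in> ?E"
        using quasi_uniformity_onD(1,2)[OF qu] by blast+
      show "(x, y) \<in> R"
      proof (rule ccontr)
        assume nR: "(x, y) \<notin> R"
        have "?ent (R\<inverse> `` {y}) (?E - R `` {x}) \<in> \<S>"
        proof (rule ent_in)
          show "R\<inverse> `` {y} \<subseteq> ?E - R `` {x}" using nR R(1,3) by blast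
        qed (use closed E increasing_set_Image[OF pre] increasing_set_complement(2)[OF pre] in auto)
        from \<S>_\<U>[OF this] have "(x, y) \<in> ?ent (R\<inverse> `` {y}) (?E - R `` {x})"
          using xy by blast
        then show False using R(2) E unfolding separating_entourage_def by blast
      qed
    qed
  qed
  ultimately show ?thesis unfolding quasi_uniformizable_def using qu by blast
qed

theorem corollary2p14:
  fixes X :: "'a topology" and R :: "('a \<times> 'a) set"
  assumes "preorder_on (topspace X) R"
    and "locally_order_convex_space X R"
    and "T2_preordered X R"
    and "locally_compact_space X"
    and "sigma_compact_space X"
  shows "order_convex_space X R \<and> normally_preordered X R \<and> quasi_uniformizable X R"
proof -
  have cl: "closedin (prod_topology X X) R"
    using assms(3) unfolding T2_preordered_def .
  have base: "neighbourhood_base_of (compactin X) X"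
    using neighbourhood_base_of_compactin[OF assms(1,2) cl assms(4)] .
  have "order_convex_space X R"
    using order_convex_space_sigma_compact[OF assms(1) cl assms(2) base assms(5)] .
  moreover have "normally_preordered X R"
    using normally_preordered_sigma_compact[OF assms(1) cl base assms(5)] .
  ultimately show ?thesis
    using quasi_uniformizable_convex_normally_preordered[OF assms(1)] by blast
qed

end
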